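(* Let $L:\mathbb{R}^d\times\mathbb{R}^d\to\mathbb{R}$, $(q,v)\mapsto L(q,v)$, be a (differentiable) Lagrangian function and let $\mathscr{L}_{\mathbb{T}}$ be the associated mid-point discrete Lagrangian functional $$\mathscr{L}_{\mathbb{T}}(q)=\int_a^b L\big(q_\circ(t),\Delta_{\circ,+}[q_\circ](t)\big)\,\Delta_{\frac12}t,\qquad q\in C(\mathbb{T},\mathbb{R}^d).$$ The discrete Euler-Lagrange equation associated to $\mathscr{L}_{\mathbb{T}}$ (the equation for its critical points $q$) is given by $$\Big[\frac{\partial L}{\partial q}(\star_\circ)\Big]_{\frac12,-}(t)=\Delta_{\frac12,-}\Big[\frac{\partial L}{\partial v}(\star_\circ)\Big](t)\qquad\text{for all } t\in\mathbb{T}_{\frac12}^{\pm},$$ where $\star_\circ(t)=(q_\circ(t),\Delta_{\circ,+}[q_\circ](t))$.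
   Context: Let $[a,b]\subset\mathbb{R}$ with $a<b$, $N\in\mathbb{N}$, $N\ge 1$, $h=(b-a)/N$. Set $\mathbb{T}=\{t_i=a+ih:\ i=0,\dots,N\}$, $t_{i+\frac12}=\frac12(t_i+t_{i+1})$, $\mathbb{T}_{\frac12}=\{t_{i+\frac12}:\ i=0,\dots,N-1\}$, $\mathbb{T}_\circ=\mathbb{T}\cup\mathbb{T}_{\frac12}$. Put $\mathbb{T}_{\frac12}^+=\mathbb{T}_{\frac12}\setminus\{t_{N-\frac12}\}$, $\mathbb{T}_{\frac12}^-=\mathbb{T}_{\frac12}\setminus\{t_{\frac12}\}$ and $\mathbb{T}_{\frac12}^{\pm}=\mathbb{T}_{\frac12}^+\cap\mathbb{T}_{\frac12}^-$. For a finite set $S$, $C(S,\mathbb{R}^d)$ is the set of all functions $S\to\mathbb{R}^d$. Extension: for $f\in C(\mathbb{T},\mathbb{R}^d)$, $f_\circ\in C(\mathbb{T}_\circ,\mathbb{R}^d)$ is defined by $f_\circ(t_i)=f(t_i)$ and $f_\circ(t_{i+\frac12})=\frac12(f(t_i)+f(t_{i+1}))$. Discrete derivatives: for $g\in C(\mathbb{T}_\circ,\mathbb{R}^d)$ and $t\in\mathbb{T}_\circ\setminus\{b\}$, $\Delta_{\circ,+}[g](t)=\dfrac{g(t+h/2)-g(t)}{h/2}$. For $f$ defined on $\mathbb{T}_{\frac12}$ and $t\in\mathbb{T}_{\frac12}^-$, $\Delta_{\frac12,-}[f](t)=\dfrac{f(t)-f(t-h)}{h}$ and $[f]_{\frac12,-}(t)=\frac12\big(f(t)+f(t-h)\big)$.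 Here $\frac{\partial L}{\partial q}(\star_\circ)$ and $\frac{\partial L}{\partial v}(\star_\circ)$ denote the functions $t\mapsto\frac{\partial L}{\partial q}(\star_\circ(t))$ and $t\mapsto\frac{\partial L}{\partial v}(\star_\circ(t))$ on $\mathbb{T}_{\frac12}$. Mid-point integral: $\int_a^b F(t)\,\Delta_{\frac12}t=h\sum_{i=0}^{N-1}F(t_{i+\frac12})$. Critical points: let $\mathscr{V}=\{v\in C(\mathbb{T},\mathbb{R}^d):\ v(a)=v(b)=0\}$. For a functional $\mathscr{L}$ on $C(\mathbb{T},\mathbb{R}^d)$ put $D\mathscr{L}(q)(v)=\lim_{\epsilon\to0}\frac{\mathscr{L}(q+\epsilon v)-\mathscr{L}(q)}{\epsilon}$; $q$ is a critical point of $\mathscr{L}$ if $D\mathscr{L}(q)(v)=0$ for all $v\in\mathscr{V}$.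
   Formalization: Critical points satisfy the equation for all t in T_{1/2}^± as printed, but the characterization (if and only if) is proved with T_{1/2}^- in place of T_{1/2}^±, since with T_{1/2}^± the converse fails (e.g. N=2, L=|v|^2/2, where T_{1/2}^± is empty). *)

theory Defs
  imports "HOL-Analysis.Analysis"
begin

definition step :: "real \<Rightarrow> real \<Rightarrow> nat \<Rightarrow> real" where
  "step a b N = (b - a) / real N"

definition node :: "real \<Rightarrow> real \<Rightarrow> nat \<Rightarrow> nat \<Rightarrow> real" where
  "node a b N i = a + real i * step a b N"

definition midnode :: "real \<Rightarrow> real \<Rightarrow> nat \<Rightarrow> nat \<Rightarrow> real" where
  "midnode a b N i = (node a b N i + node a b N (i + 1)) / 2"

definition grid :: "real \<Rightarrow> real \<Rightarrow> nat \<Rightarrow> real set" where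
  "grid a b N = node a b N ` {0..N}"

definition grid_half :: "real \<Rightarrow> real \<Rightarrow> nat \<Rightarrow> real set" where
  "grid_half a b N = midnode a b N ` {0..<N}"

definition grid_full :: "real \<Rightarrow> real \<Rightarrow> nat \<Rightarrow> real set" where
  "grid_full a b N = grid a b N \<union> grid_half a b N"

definition grid_half_plus :: "real \<Rightarrow> real \<Rightarrow> nat \<Rightarrow> real set" where
  "grid_half_plus a b N = grid_half a b N - {midnode a b N (N - 1)}"

definition grid_half_minus :: "real \<Rightarrow> real \<Rightarrow> nat \<Rightarrow> real set" where
  "grid_half_minus a b N = grid_half a b N - {midnode a b N 0}"

definition grid_half_pm :: "real \<Rightarrow> real \<Rightarrow> nat \<Rightarrow> real set" where
  "grid_half_pm a b N = grid_half_plus a b N \<inter> grid_half_minus a b N"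

text \<open>Functions on a finite set \<open>S\<close> are extensional, so that each is represented exactly once.\<close>

definition funs_on :: "real set \<Rightarrow> (real \<Rightarrow> real ^ 'd) set" where
  "funs_on S = S \<rightarrow>\<^sub>E UNIV"

text \<open>The extension \<open>f\<^sub>\<circ>\<close> of a function on the grid to the full grid. If \<open>s\<close> is the midpoint
  of \<open>t\<^sub>i\<close> and \<open>t\<^sub>i\<^sub>+\<^sub>1\<close>, then \<open>s - h/2 = t\<^sub>i\<close> and \<open>s + h/2 = t\<^sub>i\<^sub>+\<^sub>1\<close>; see the lemmas
  \<open>extend_node\<close> and \<open>extend_midnode\<close> below.\<close>

definition extend :: "real \<Rightarrow> real \<Rightarrow> nat \<Rightarrow> (real \<Rightarrow> real ^ 'd) \<Rightarrow> real \<Rightarrow> real ^ 'd" where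
  "extend a b N f = (\<lambda>s\<in>grid_full a b N.
     if s \<in> grid a b N then f s
     else (1/2) *\<^sub>R (f (s - step a b N / 2) + f (s + step a b N / 2)))"

text \<open>The discrete operators are given by their formulas at every real \<open>t\<close>; the formulas are
  meaningful for \<open>t\<close> in the full grid without \<open>b\<close> (for \<open>delta_full_plus\<close>) and for \<open>t\<close>
  in \<open>grid_half_minus\<close> (for the other two).\<close>

definition delta_full_plus ::
  "real \<Rightarrow> real \<Rightarrow> nat \<Rightarrow> (real \<Rightarrow> real ^ 'd) \<Rightarrow> real \<Rightarrow> real ^ 'd" where
  "delta_full_plus a b N g t = (g (t + step a b N / 2) - g t) /\<^sub>R (step a b N / 2)"

definition delta_half_minus ::
  "real \<Rightarrow> real \<Rightarrow> nat \<Rightarrow> (real \<Rightarrow> real ^ 'd) \<Rightarrow> real \<Rightarrow> real ^ 'd" where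
  "delta_half_minus a b N f t = (f t - f (t - step a b N)) /\<^sub>R step a b N"

definition avg_half_minus ::
  "real \<Rightarrow> real \<Rightarrow> nat \<Rightarrow> (real \<Rightarrow> real ^ 'd) \<Rightarrow> real \<Rightarrow> real ^ 'd" where
  "avg_half_minus a b N f t = (1/2) *\<^sub>R (f t + f (t - step a b N))"

definition midpoint_integral :: "real \<Rightarrow> real \<Rightarrow> nat \<Rightarrow> (real \<Rightarrow> real) \<Rightarrow> real" where
  "midpoint_integral a b N F = step a b N * (\<Sum>i<N. F (midnode a b N i))"

definition grad_q :: "((real ^ 'd) \<times> (real ^ 'd) \<Rightarrow> real) \<Rightarrow> (real ^ 'd) \<times> (real ^ 'd) \<Rightarrow> real ^ 'd" where
  "grad_q L z = (\<chi> k. deriv (\<lambda>s. L (fst z + s *\<^sub>R axis k 1, snd z)) 0)"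

definition grad_v :: "((real ^ 'd) \<times> (real ^ 'd) \<Rightarrow> real) \<Rightarrow> (real ^ 'd) \<times> (real ^ 'd) \<Rightarrow> real ^ 'd" where
  "grad_v L z = (\<chi> k. deriv (\<lambda>s. L (fst z, snd z + s *\<^sub>R axis k 1)) 0)"

definition star :: "real \<Rightarrow> real \<Rightarrow> nat \<Rightarrow> (real \<Rightarrow> real ^ 'd) \<Rightarrow> real \<Rightarrow> (real ^ 'd) \<times> (real ^ 'd)" where
  "star a b N q t = (extend a b N q t, delta_full_plus a b N (extend a b N q) t)"

definition discrete_lagrangian ::
  "real \<Rightarrow> real \<Rightarrow> nat \<Rightarrow> ((real ^ 'd) \<times> (real ^ 'd) \<Rightarrow> real) \<Rightarrow> (real \<Rightarrow> real ^ 'd) \<Rightarrow> real" where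
  "discrete_lagrangian a b N L q = midpoint_integral a b N (\<lambda>t. L (star a b N q t))"

definition variations :: "real \<Rightarrow> real \<Rightarrow> nat \<Rightarrow> (real \<Rightarrow> real ^ 'd) set" where
  "variations a b N = {v \<in> funs_on (grid a b N). v a = 0 \<and> v b = 0}"

text \<open>\<open>has_variation a b N J q v D\<close> says that the limit defining the derivative of the
  functional \<open>J\<close> at \<open>q\<close> in direction \<open>v\<close> exists and equals \<open>D\<close>. The restriction makes
  \<open>q + \<epsilon> v\<close> an element of the function space on the grid.\<close>

definition has_variation ::
  "real \<Rightarrow> real \<Rightarrow> nat \<Rightarrow> ((real \<Rightarrow> real ^ 'd) \<Rightarrow> real) \<Rightarrow> (real \<Rightarrow> real ^ 'd) \<Rightarrow>
   (real \<Rightarrow> real ^ 'd) \<Rightarrow> real \<Rightarrow> bool" where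
  "has_variation a b N J q v D \<longleftrightarrow>
     ((\<lambda>\<epsilon>. (J (\<lambda>t\<in>grid a b N. q t + \<epsilon> *\<^sub>R v t) - J q) / \<epsilon>) \<longlongrightarrow> D) (at 0)"

definition critical_point ::
  "real \<Rightarrow> real \<Rightarrow> nat \<Rightarrow> ((real \<Rightarrow> real ^ 'd) \<Rightarrow> real) \<Rightarrow> (real \<Rightarrow> real ^ 'd) \<Rightarrow> bool" where
  "critical_point a b N J q \<longleftrightarrow> (\<forall>v\<in>variations a b N. has_variation a b N J q v 0)"

definition discrete_euler_lagrange ::
  "real \<Rightarrow> real \<Rightarrow> nat \<Rightarrow> ((real ^ 'd) \<times> (real ^ 'd) \<Rightarrow> real) \<Rightarrow> (real \<Rightarrow> real ^ 'd) \<Rightarrow> real \<Rightarrow> bool" where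
  "discrete_euler_lagrange a b N L q t \<longleftrightarrow>
     avg_half_minus a b N (\<lambda>s. grad_q L (star a b N q s)) t =
     delta_half_minus a b N (\<lambda>s. grad_v L (star a b N q s)) t"

lemma extend_node:
  assumes "i \<le> N"
  shows "extend a b N f (node a b N i) = f (node a b N i)"
  using assms by (auto simp: extend_def grid_full_def grid_def)

lemma midnode_notin_grid:
  assumes "a < b" "N \<ge> 1"
  shows "midnode a b N i \<notin> grid a b N"
proof
  assume "midnode a b N i \<in> grid a b N"
  then obtain j where "midnode a b N i = node a b N j"
    by (auto simp: grid_def)
  then have "(2 * real i + 1) * step a b N = (2 * real j) * step a b N"
    by (simp add: midnode_def node_def field_simps)
  moreover have "step a b N \<noteq> 0"
    using assms by (simp add: step_def)
  ultimately have "real (2 * i + 1) = real (2 * j)"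
    by simp
  then have "2 * i + 1 = 2 * j"
    by (simp only: of_nat_eq_iff)
  then show False
    by presburger
qed

lemma extend_midnode:
  assumes "a < b" "i < N"
  shows "extend a b N f (midnode a b N i) =
    (1/2) *\<^sub>R (f (node a b N i) + f (node a b N (i + 1)))"
proof -
  have "midnode a b N i \<in> grid_full a b N"
    using assms by (auto simp: grid_full_def grid_half_def)
  moreover have "midnode a b N i \<notin> grid a b N"
    using assms by (intro midnode_notin_grid) auto
  moreover have "midnode a b N i - step a b N / 2 = node a b N i"
    "midnode a b N i + step a b N / 2 = node a b N (i + 1)"
    by (simp_all add: midnode_def node_def field_simps)
  ultimately show ?thesis
    by (simp add: extend_def)
qed

end

theory Submission
  imports Defs
begin

text \<open>
  With \<open>g\<^sub>i\<close> and \<open>p\<^sub>i\<close> the two partial gradients of \<open>L\<close> at the \<open>i\<close>-th midpoint, the chain rule shows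
  that the variation in direction \<open>v\<close> is
  \<open>h \<Sum> (g\<^sub>i \<bullet> (v\<^sub>i + v\<^sub>i\<^sub>+\<^sub>1) / 2 + p\<^sub>i \<bullet> (v\<^sub>i\<^sub>+\<^sub>1 - v\<^sub>i) / h)\<close>. Collecting the coefficient of each
  \<open>v\<^sub>i\<close> (the boundary terms vanish) turns this into \<open>h \<Sum> E\<^sub>i \<bullet> v\<^sub>i\<close>, where \<open>E\<^sub>i\<close> is the difference of
  the two sides of the Euler-Lagrange equation at \<open>t\<^sub>i\<^sub>+\<^sub>\<onehalf>\<close>. Testing with \<open>v\<close> equal to \<open>E\<^sub>i\<close> at a single
  node \<open>t\<^sub>i\<close> and zero elsewhere forces \<open>E\<^sub>i = 0\<close>.
\<close>

lemma step_pos: "a < b \<Longrightarrow> N \<ge> 1 \<Longrightarrow> step a b N > 0"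
  by (simp add: step_def)

lemma node_0 [simp]: "node a b N 0 = a"
  by (simp add: node_def)

lemma node_N: "N \<ge> 1 \<Longrightarrow> node a b N N = b"
  by (simp add: node_def step_def)

lemma node_eq_iff:
  assumes "a < b" "N \<ge> 1"
  shows "node a b N i = node a b N j \<longleftrightarrow> i = j"
  using step_pos[OF assms] by (simp add: node_def)

lemma midnode_eq_iff:
  assumes "a < b" "N \<ge> 1"
  shows "midnode a b N i = midnode a b N j \<longleftrightarrow> i = j"
  using step_pos[OF assms] by (simp add: midnode_def node_def field_simps)

lemma midnode_Suc_minus_step: "midnode a b N (Suc i) - step a b N = midnode a b N i"
  by (simp add: midnode_def node_def field_simps)

lemma node_in_grid: "i \<le> N \<Longrightarrow> node a b N i \<in> grid a b N"
  by (simp add: grid_def)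

text \<open>The shift by \<open>Suc\<close> pairs each of these midpoints with its left endpoint
  \<open>node a b N (Suc i)\<close>, and these endpoints are exactly the interior nodes. So there is
  one equation per free value of a variation.\<close>

lemma grid_half_minus_eq:
  assumes "a < b" "N \<ge> 1"
  shows "grid_half_minus a b N = (\<lambda>i. midnode a b N (Suc i)) ` {..<N - 1}"
proof -
  have "grid_half_minus a b N = midnode a b N ` {1..<N}"
    using assms by (auto simp: grid_half_minus_def grid_half_def midnode_eq_iff)
  also have "{1..<N} = Suc ` {..<N - 1}"
    using assms by (simp add: lessThan_atLeast0 image_Suc_atLeastLessThan)
  finally show ?thesis
    by (simp add: image_image)
qed

text \<open>A half step from a midpoint covers half of the increment between neighbouring nodes, so
  dividing by h/2 gives the difference quotient over the whole cell.\<close>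

lemma star_midnode:
  assumes "a < b" "i < N"
  shows "star a b N q (midnode a b N i) =
    ((1/2) *\<^sub>R (q (node a b N i) + q (node a b N (Suc i))),
     (q (node a b N (Suc i)) - q (node a b N i)) /\<^sub>R step a b N)"
proof -
  let ?x = "q (node a b N i)" and ?y = "q (node a b N (Suc i))"
  have "midnode a b N i + step a b N / 2 = node a b N (Suc i)"
    by (simp add: midnode_def node_def field_simps)
  then have "star a b N q (midnode a b N i) =
      ((1/2) *\<^sub>R (?x + ?y), (?y - (1/2) *\<^sub>R (?x + ?y)) /\<^sub>R (step a b N / 2))"
    using assms by (simp add: star_def delta_full_plus_def extend_midnode extend_node)
  also have "?y - (1/2) *\<^sub>R (?x + ?y) = (1/2) *\<^sub>R (?y - ?x)"
    by (simp add: vec_eq_iff field_simps)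
  finally show ?thesis
    by (simp add: inverse_eq_divide)
qed

text \<open>By linearity of \<open>star\<close> in the grid function, a variation moves each
  argument of \<open>L\<close> along a straight line, so only directional derivatives of
  \<open>L\<close> enter.\<close>

lemma star_midnode_variation:
  assumes "a < b" "i < N"
  shows "star a b N (\<lambda>t\<in>grid a b N. q t + e *\<^sub>R v t) (midnode a b N i) =
    star a b N q (midnode a b N i) + e *\<^sub>R star a b N v (midnode a b N i)"
  using assms by (simp add: star_midnode node_in_grid algebra_simps vec_eq_iff)

lemma has_derivative_imp_DERIV_line:
  fixes L :: "'a::real_normed_vector \<Rightarrow> real"
  assumes "(L has_derivative D) (at z)"
  shows "((\<lambda>s. L (z + s *\<^sub>R w)) has_field_derivative D w) (at 0)"
proof -
  interpret D: bounded_linear D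
    using assms by (rule has_derivative_bounded_linear)
  have "((\<lambda>s. z + s *\<^sub>R w) has_derivative (\<lambda>s. s *\<^sub>R w)) (at 0)"
    by (auto intro!: derivative_eq_intros)
  then have "((\<lambda>s. L (z + s *\<^sub>R w)) has_derivative (\<lambda>s. D (s *\<^sub>R w))) (at 0)"
    using has_derivative_compose[of "\<lambda>s. z + s *\<^sub>R w" _ 0 UNIV L D] assms by simp
  then show ?thesis
    by (simp add: has_field_derivative_def D.scaleR mult_commute_abs)
qed

text \<open>The gradients are built from \<open>deriv\<close>, which is meaningful only where the
  partial derivatives exist. Differentiability provides them, and linearity recovers the full
  derivative from its values on the coordinate axes.\<close>

lemma has_derivative_grad:
  fixes L :: "(real ^ 'd) \<times> (real ^ 'd) \<Rightarrow> real"
  assumes "L differentiable at z"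
  shows "(L has_derivative (\<lambda>w. grad_q L z \<bullet> fst w + grad_v L z \<bullet> snd w)) (at z)"
proof -
  obtain D where D: "(L has_derivative D) (at z)"
    using assms by (auto simp: differentiable_def)
  interpret D: bounded_linear D
    using D by (rule has_derivative_bounded_linear)
  note dir = has_derivative_imp_DERIV_line[OF D]
  have q: "grad_q L z $ k = D (axis k 1, 0)" for k
    using DERIV_imp_deriv[OF dir[of "(axis k 1, 0)"]]
    by (cases z) (simp add: grad_q_def)
  have v: "grad_v L z $ k = D (0, axis k 1)" for k
    using DERIV_imp_deriv[OF dir[of "(0, axis k 1)"]]
    by (cases z) (simp add: grad_v_def)
  have "D w = grad_q L z \<bullet> fst w + grad_v L z \<bullet> snd w" for w
  proof -
    obtain x y where w: "w = (x, y)"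
      by (cases w)
    have "(\<Sum>k\<in>UNIV. x $ k *\<^sub>R axis k 1) = x" for x :: "real ^ 'd"
      using basis_expansion[of x] by (simp add: scalar_mult_eq_scaleR)
    then have "w = (\<Sum>k\<in>UNIV. x $ k *\<^sub>R (axis k 1, 0)) + (\<Sum>k\<in>UNIV. y $ k *\<^sub>R (0, axis k 1))"
      by (simp add: w prod_eq_iff fst_sum snd_sum)
    then have "D w = (\<Sum>k\<in>UNIV. x $ k * D (axis k 1, 0)) + (\<Sum>k\<in>UNIV. y $ k * D (0, axis k 1))"
      by (simp only: D.add D.sum D.scaleR real_scaleR_def)
    then show ?thesis
      by (simp add: w q v inner_vec_def mult.commute)
  qed
  then have "D = (\<lambda>w. grad_q L z \<bullet> fst w + grad_v L z \<bullet> snd w)"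
    by (rule ext)
  then show ?thesis
    using D by simp
qed

lemma has_variation_iff_DERIV:
  fixes q v :: "real \<Rightarrow> real ^ 'd"
  assumes "q \<in> funs_on (grid a b N)"
  shows "has_variation a b N J q v D \<longleftrightarrow>
    ((\<lambda>e. J (\<lambda>t\<in>grid a b N. q t + e *\<^sub>R v t)) has_field_derivative D) (at 0)"
proof -
  \<comment> \<open>At \<open>e = 0\<close> the varied function is this restriction; it must be
    \<open>q\<close> itself for the quotient to subtract \<open>J q\<close>.\<close>
  have "restrict q (grid a b N) = q"
    using assms by (auto simp: funs_on_def PiE_def extensional_restrict)
  then show ?thesis
    by (simp add: has_variation_def DERIV_def)
qed

text \<open>Each interior value of \<open>w\<close> occurs twice, as the left end of one cell and as
  the right end of the preceding one; the two outermost terms vanish.\<close>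

lemma sum_by_parts_shift:
  fixes \<alpha> \<beta> w :: "nat \<Rightarrow> 'a::real_inner"
  assumes "w 0 = 0" "w (Suc n) = 0"
  shows "(\<Sum>i<Suc n. \<alpha> i \<bullet> w i + \<beta> i \<bullet> w (Suc i)) = (\<Sum>i<n. (\<alpha> (Suc i) + \<beta> i) \<bullet> w (Suc i))"
proof -
  have "(\<Sum>i<Suc n. \<alpha> i \<bullet> w i) = (\<Sum>i<n. \<alpha> (Suc i) \<bullet> w (Suc i))"
    using assms by (simp add: sum.lessThan_Suc_shift del: sum.lessThan_Suc)
  moreover have "(\<Sum>i<Suc n. \<beta> i \<bullet> w (Suc i)) = (\<Sum>i<n. \<beta> i \<bullet> w (Suc i))"
    using assms by simp
  ultimately show ?thesis
    by (simp only: sum.distrib inner_add_left)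
qed

definition euler_lagrange_residual ::
  "real \<Rightarrow> real \<Rightarrow> nat \<Rightarrow> ((real ^ 'd) \<times> (real ^ 'd) \<Rightarrow> real) \<Rightarrow> (real \<Rightarrow> real ^ 'd) \<Rightarrow> real \<Rightarrow> real ^ 'd"
  where "euler_lagrange_residual a b N L q t =
    avg_half_minus a b N (\<lambda>s. grad_q L (star a b N q s)) t -
    delta_half_minus a b N (\<lambda>s. grad_v L (star a b N q s)) t"

lemma has_variation_discrete_lagrangian:
  fixes L :: "(real ^ 'd) \<times> (real ^ 'd) \<Rightarrow> real"
  assumes "a < b" "N \<ge> 1" "L differentiable_on UNIV" "q \<in> funs_on (grid a b N)"
    "v \<in> variations a b N"
  shows "has_variation a b N (discrete_lagrangian a b N L) q v
    (step a b N * (\<Sum>i<N - 1. euler_lagrange_residual a b N L q (midnode a b N (Suc i)) \<bullet>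
                               v (node a b N (Suc i))))"
proof -
  define h where "h = step a b N"
  define z where "z i = star a b N q (midnode a b N i)" for i
  define u where "u i = star a b N v (midnode a b N i)" for i
  define g where "g i = grad_q L (z i)" for i
  define p where "p i = grad_v L (z i)" for i
  define w where "w i = v (node a b N i)" for i
  obtain n where N: "N = Suc n"
    using \<open>N \<ge> 1\<close> by (cases N) auto
  have w0: "w 0 = 0" "w (Suc n) = 0"
    using assms node_N[of N a b] by (auto simp: w_def variations_def N)
  have dterm: "((\<lambda>e. L (z i + e *\<^sub>R u i)) has_field_derivative (g i \<bullet> fst (u i) + p i \<bullet> snd (u i))) (at 0)" for i
  proof -
    have "L differentiable at (z i)"
      using assms(3) unfolding differentiable_on_def by blast
    from has_derivative_imp_DERIV_line[OF has_derivative_grad[OF this]] show ?thesis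
      by (simp add: g_def p_def)
  qed
  have "((\<lambda>e. h * (\<Sum>i<N. L (z i + e *\<^sub>R u i))) has_field_derivative
      h * (\<Sum>i<N. g i \<bullet> fst (u i) + p i \<bullet> snd (u i))) (at 0)"
    by (intro DERIV_cmult DERIV_sum dterm)
  moreover have "discrete_lagrangian a b N L (\<lambda>t\<in>grid a b N. q t + e *\<^sub>R v t) =
      h * (\<Sum>i<N. L (z i + e *\<^sub>R u i))" for e
    using \<open>a < b\<close> by (simp add: discrete_lagrangian_def midpoint_integral_def star_midnode_variation
        h_def z_def u_def)
  \<comment> \<open>The mean in \<open>star\<close> gives both ends of a cell the weight 1/2 on
    \<open>g i\<close>; the difference quotient gives \<open>p i\<close> the weights -1/h on the
    left and 1/h on the right.\<close>
  moreover have "(\<Sum>i<N. g i \<bullet> fst (u i) + p i \<bullet> snd (u i)) =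
      (\<Sum>i<Suc n. ((1/2) *\<^sub>R g i - p i /\<^sub>R h) \<bullet> w i + ((1/2) *\<^sub>R g i + p i /\<^sub>R h) \<bullet> w (Suc i))"
    unfolding N[symmetric]
    using \<open>a < b\<close> by (intro sum.cong)
      (simp_all add: u_def star_midnode w_def h_def algebra_simps inner_simps)
  moreover have "\<dots> = (\<Sum>i<n. (((1/2) *\<^sub>R g (Suc i) - p (Suc i) /\<^sub>R h) +
      ((1/2) *\<^sub>R g i + p i /\<^sub>R h)) \<bullet> w (Suc i))"
    using w0 by (rule sum_by_parts_shift)
  moreover have "((1/2) *\<^sub>R g (Suc i) - p (Suc i) /\<^sub>R h) + ((1/2) *\<^sub>R g i + p i /\<^sub>R h) =
      euler_lagrange_residual a b N L q (midnode a b N (Suc i))" for i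
    by (simp add: euler_lagrange_residual_def avg_half_minus_def delta_half_minus_def
        midnode_Suc_minus_step g_def p_def z_def h_def algebra_simps)
  ultimately show ?thesis
    unfolding has_variation_iff_DERIV[OF assms(4)] by (simp add: w_def h_def N)
qed

lemma critical_point_iff_residual:
  fixes L :: "(real ^ 'd) \<times> (real ^ 'd) \<Rightarrow> real"
  assumes "a < b" "N \<ge> 1" "L differentiable_on UNIV" "q \<in> funs_on (grid a b N)"
  shows "critical_point a b N (discrete_lagrangian a b N L) q \<longleftrightarrow>
    (\<forall>i<N - 1. euler_lagrange_residual a b N L q (midnode a b N (Suc i)) = 0)"
    (is "?crit \<longleftrightarrow> (\<forall>i<N - 1. ?E i = 0)")
proof
  assume "\<forall>i<N - 1. ?E i = 0"
  then show ?crit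
    unfolding critical_point_def
    using has_variation_discrete_lagrangian[OF assms] by auto
next
  assume crit: ?crit
  show "\<forall>i<N - 1. ?E i = 0"
  proof (intro allI impI)
    fix j assume j: "j < N - 1"
    define v where "v = (\<lambda>t\<in>grid a b N. if t = node a b N (Suc j) then ?E j else 0)"
    \<comment> \<open>The bound \<open>j < N - 1\<close> makes this node interior, so
      \<open>v\<close> vanishes at both ends.\<close>
    have "node a b N (Suc j) \<noteq> a" "node a b N (Suc j) \<noteq> b"
      using node_eq_iff[OF assms(1,2), of "Suc j" 0] node_eq_iff[OF assms(1,2), of "Suc j" N]
        node_N[OF assms(2), of a b] j by auto
    moreover have "a \<in> grid a b N" "b \<in> grid a b N"
      using node_in_grid[of 0 N a b] node_in_grid[of N N a b] node_N[OF assms(2), of a b] by auto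
    ultimately have v: "v \<in> variations a b N"
      by (simp add: variations_def v_def funs_on_def)
    have "has_variation a b N (discrete_lagrangian a b N L) q v 0"
      using crit v by (simp add: critical_point_def)
    with has_variation_discrete_lagrangian[OF assms v]
    have "step a b N * (\<Sum>i<N - 1. ?E i \<bullet> v (node a b N (Suc i))) = 0"
      unfolding has_variation_iff_DERIV[OF assms(4)] by (rule DERIV_unique)
    \<comment> \<open>Only the chosen node contributes, which leaves the squared norm of
      \<open>?E j\<close> times the positive step.\<close>
    moreover have "(\<Sum>i<N - 1. ?E i \<bullet> v (node a b N (Suc i))) = (\<Sum>i<N - 1. if i = j then ?E j \<bullet> ?E j else 0)"
      by (intro sum.cong) (auto simp: v_def node_in_grid node_eq_iff[OF assms(1,2)])
    ultimately show "?E j = 0"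
      using step_pos[OF assms(1,2)] j by simp
  qed
qed

text \<open>The equivalence lives on \<open>grid_half_minus\<close>, where every interior node has
  its equation. The smaller set \<open>grid_half_pm\<close> omits the last midpoint, hence the
  equation from varying the last interior node, so on it only the necessity of the equation is
  stated.\<close>

theorem theorem1:
  fixes L :: "(real ^ 'd) \<times> (real ^ 'd) \<Rightarrow> real"
    and a b :: real and N :: nat
    and q :: "real \<Rightarrow> real ^ 'd"
  assumes "a < b" and "N \<ge> 1"
    and "L differentiable_on UNIV"
    and "q \<in> funs_on (grid a b N)"
  shows "(critical_point a b N (discrete_lagrangian a b N L) q \<longrightarrow>
           (\<forall>t\<in>grid_half_pm a b N. discrete_euler_lagrange a b N L q t)) \<and>
         (critical_point a b N (discrete_lagrangian a b N L) q \<longleftrightarrow>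
           (\<forall>t\<in>grid_half_minus a b N. discrete_euler_lagrange a b N L q t))"
proof -
  have "critical_point a b N (discrete_lagrangian a b N L) q \<longleftrightarrow>
      (\<forall>t\<in>grid_half_minus a b N. discrete_euler_lagrange a b N L q t)"
    unfolding critical_point_iff_residual[OF assms] grid_half_minus_eq[OF assms(1,2)]
    by (auto simp: euler_lagrange_residual_def discrete_euler_lagrange_def)
  then show ?thesis
    by (auto simp: grid_half_pm_def)
qed

end
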